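(* Let $\alpha_1,\dots,\alpha_N>0$ and let $W(x)=e^{-x^2}L(x)L(x)^*$, $x\in\mathbb{R}$, where $L(x)$ is the lower triangular $N\times N$ matrix with entries $$L(x)_{j,k}=\frac{H_{j-k}(x)}{(j-k)!}\frac{\alpha_j}{\alpha_k}\ \ (j\ge k),\qquad L(x)_{j,k}=0\ \ (j<k),$$ and $H_n$ are the scalar Hermite polynomials. Then the squared norms $\mathcal{H}(n)$ of the monic matrix valued orthogonal polynomials with respect to $W$ and the three-term recurrence coefficients $C(n)$ are diagonal matrices for all $n\in\mathbb{N}_0$.
   Context: $H_n$ are the standard (physicists') Hermite polynomials, orthogonal with respect to $e^{-x^2}$ with leading coefficient $2^n$. With $\langle F,G\rangle=\int_{\mathbb{R}}F(y)W(y)G(y)^*\,dy$, the monic MVOPs $P(x,n)=x^nI+\cdots$ satisfy $\langle P(\cdot,n),P(\cdot,m)\rangle=\mathcal{H}(n)\delta_{n,m}$ and $xP(x,n)=P(x,n+1)+B(n)P(x,n)+C(n)P(x,n-1)$, where $C(n)=\mathcal{H}(n)\mathcal{H}(n-1)^{-1}$ for $n\ge1$ and $C(0):=0$. *)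

theory Defs
  imports
    "HOL-Probability.Distributions"
    "HOL-Computational_Algebra.Polynomial"
    "Jordan_Normal_Form.Schur_Decomposition"
begin

fun hermite :: "nat \<Rightarrow> real poly" where
  "hermite 0 = 1"
| "hermite (Suc 0) = [:0, 2:]"
| "hermite (Suc (Suc n)) =
     [:0, 2:] * hermite (Suc n) - Polynomial.smult (2 * of_nat (Suc n)) (hermite n)"

lemma degree_lead_coeff_hermite:
  "degree (hermite n) = n \<and> lead_coeff (hermite n) = 2 ^ n"
proof (induction n rule: hermite.induct)
  case (3 n)
  have nz: "hermite (Suc n) \<noteq> 0" using 3 by auto
  let ?p = "[:0, 2:] * hermite (Suc n)" and ?q = "Polynomial.smult (2 * of_nat (Suc n)) (hermite n)"
  have dp: "degree ?p = Suc (Suc n)" using 3 nz by (subst degree_mult_eq) auto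
  have "degree ?q < degree ?p" using 3 dp by simp
  moreover have "lead_coeff (hermite (Suc n)) = 2 ^ Suc n" using 3 by metis
  then have "lead_coeff ?p = 2 ^ Suc (Suc n)" by (simp only: lead_coeff_mult) simp
  ultimately show ?case
    unfolding hermite.simps(3)
    using dp degree_add_eq_left[of "- ?q" ?p] coeff_eq_0[of ?q "Suc (Suc n)"] by simp
qed simp_all

lemma pderiv_hermite: "pderiv (hermite (Suc n)) = Polynomial.smult (2 * of_nat (Suc n)) (hermite n)"
proof (induction n rule: less_induct)
  case (less n)
  show ?case
  proof (cases n)
    case 0
    then show ?thesis by (simp add: pderiv_pCons)
  next
    case (Suc m)
    show ?thesis
    proof (cases m)
      case 0
      then show ?thesis using Suc by (simp add: pderiv_pCons pderiv_diff pderiv_smult pderiv_mult one_pCons)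
    next
      case (Suc k)
      have 1: "pderiv (hermite (Suc m)) = Polynomial.smult (2 * of_nat (Suc m)) (hermite m)"
        using less[of m] \<open>n = Suc m\<close> by simp
      have 2: "pderiv (hermite m) = Polynomial.smult (2 * of_nat m) (hermite k)"
        using less[of k] \<open>n = Suc m\<close> Suc by simp
      have 3: "hermite (Suc m) = [:0, 2:] * hermite m - Polynomial.smult (2 * of_nat m) (hermite k)"
        using Suc by simp
      have "pderiv (hermite (Suc n)) =
          Polynomial.smult 2 (hermite (Suc m)) + [:0, 2:] * pderiv (hermite (Suc m))
            - Polynomial.smult (2 * of_nat (Suc m)) (pderiv (hermite m))"
        unfolding \<open>n = Suc m\<close> hermite.simps(3)[of m] pderiv_diff pderiv_smult pderiv_mult
        by (simp add: pderiv_pCons)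
      also have "\<dots> = Polynomial.smult 2 (hermite (Suc m)) + Polynomial.smult (2 * of_nat (Suc m)) (hermite (Suc m))"
        unfolding 1 2 by (subst (3) 3) (simp add: algebra_simps smult_diff_right)
      also have "\<dots> = Polynomial.smult (2 * of_nat (Suc n)) (hermite n)"
        unfolding \<open>n = Suc m\<close> smult_add_left[symmetric] by (simp add: algebra_simps)
      finally show ?thesis .
    qed
  qed
qed

lemma hermite_Suc: "hermite (Suc n) = [:0, 2:] * hermite n - pderiv (hermite n)"
  by (cases n) (simp_all only: pderiv_hermite hermite.simps, simp_all)

definition gauss_moment :: "nat \<Rightarrow> real" where
  "gauss_moment k = (if even k then sqrt pi * (fact k / (2 ^ k * fact (k div 2))) else 0)"

lemma gauss_moment: "has_bochner_integral lborel (\<lambda>x::real. exp (- x\<^sup>2) * x ^ k) (gauss_moment k)"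
proof (cases "even k")
  case True
  then obtain m where m: "k = 2 * m" by blast
  show ?thesis
    using has_bochner_integral_even_function[OF gaussian_moment_even_pos[of m]]
    unfolding m gauss_moment_def by simp
next
  case False
  then obtain m where m: "k = 2 * m + 1" by (rule oddE)
  show ?thesis
    using has_bochner_integral_odd_function[OF gaussian_moment_odd_pos[of m]]
    unfolding m gauss_moment_def by simp
qed

lemma gauss_moment_rec: "2 * gauss_moment (Suc k) = of_nat k * gauss_moment (k - 1)"
proof (cases "odd k")
  case True
  then obtain m where m: "k = 2 * m + 1" by (rule oddE)
  have "1 + real m \<noteq> 0" "real m + 1 \<noteq> 0" by linarith+
  then show ?thesis unfolding m gauss_moment_def by (simp add: divide_simps)
next
  case False
  then show ?thesis by (cases k) (auto simp: gauss_moment_def)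
qed

lemma gauss_poly_integral:
  fixes p :: "real poly"
  shows "has_bochner_integral lborel (\<lambda>x. exp (- x\<^sup>2) * poly p x)
    (\<Sum>i\<le>degree p. coeff p i * gauss_moment i)"
proof -
  have "has_bochner_integral lborel (\<lambda>x. \<Sum>i\<le>degree p. coeff p i * (exp (- x\<^sup>2) * x ^ i))
    (\<Sum>i\<le>degree p. coeff p i * gauss_moment i)"
    by (intro has_bochner_integral_sum has_bochner_integral_mult_right gauss_moment)
  then show ?thesis
    by (simp add: poly_altdef sum_distrib_left mult_ac)
qed

lemma gauss_poly_integrable [simp]:
  "integrable lborel (\<lambda>x. exp (- x\<^sup>2) * poly p x)" for p :: "real poly"
  using gauss_poly_integral[of p] unfolding has_bochner_integral_iff by blast

lemma gauss_poly_integral_eq: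
  fixes p :: "real poly"
  assumes "degree p \<le> n"
  shows "(LINT x|lborel. exp (- x\<^sup>2) * poly p x) = (\<Sum>i\<le>n. coeff p i * gauss_moment i)"
proof -
  have "(\<Sum>i\<le>degree p. coeff p i * gauss_moment i) = (\<Sum>i\<le>n. coeff p i * gauss_moment i)"
    using assms by (intro sum.mono_neutral_left) (auto simp: coeff_eq_0)
  then show ?thesis
    using has_bochner_integral_integral_eq[OF gauss_poly_integral[of p]] by simp
qed

lemma gauss_by_parts:
  fixes p :: "real poly"
  shows "(LINT x|lborel. exp (- x\<^sup>2) * poly ([:0, 2:] * p) x) =
    (LINT x|lborel. exp (- x\<^sup>2) * poly (pderiv p) x)"
proof -
  let ?d = "degree p"
  have "degree ([:0, 2:] * p) \<le> Suc ?d"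
    using degree_mult_le[of "[:0, 2:]" p] by simp
  then have "(LINT x|lborel. exp (- x\<^sup>2) * poly ([:0, 2:] * p) x) =
      (\<Sum>i\<le>Suc ?d. coeff ([:0, 2:] * p) i * gauss_moment i)"
    by (rule gauss_poly_integral_eq)
  also have "\<dots> = (\<Sum>i\<le>?d. coeff p i * (2 * gauss_moment (Suc i)))"
    by (subst sum.atMost_Suc_shift) (simp add: mult_ac)
  also have "\<dots> = (\<Sum>i\<le>Suc ?d. coeff p i * (of_nat i * gauss_moment (i - 1)))"
    unfolding gauss_moment_rec by (simp add: coeff_eq_0)
  also have "\<dots> = (\<Sum>i\<le>?d. coeff (pderiv p) i * gauss_moment i)"
    by (subst sum.atMost_Suc_shift) (simp add: coeff_pderiv mult_ac)
  also have "\<dots> = (LINT x|lborel. exp (- x\<^sup>2) * poly (pderiv p) x)"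
    by (rule gauss_poly_integral_eq[symmetric]) (simp add: degree_pderiv)
  finally show ?thesis .
qed

lemma hermite_orthogonal_lower:
  "degree q < n \<Longrightarrow> (LINT x|lborel. exp (- x\<^sup>2) * poly (hermite n * q) x) = 0"
proof (induction n arbitrary: q)
  case (Suc n)
  have "(LINT x|lborel. exp (- x\<^sup>2) * poly (hermite (Suc n) * q) x) =
      (LINT x|lborel. exp (- x\<^sup>2) * poly ([:0, 2:] * (hermite n * q)) x
        - exp (- x\<^sup>2) * poly (pderiv (hermite n) * q) x)"
    unfolding hermite_Suc by (intro Bochner_Integration.integral_cong refl) (simp add: algebra_simps)
  also have "\<dots> = (LINT x|lborel. exp (- x\<^sup>2) * poly (pderiv (hermite n * q)) x)
      - (LINT x|lborel. exp (- x\<^sup>2) * poly (pderiv (hermite n) * q) x)"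
    unfolding gauss_by_parts[symmetric]
    by (rule Bochner_Integration.integral_diff) (rule gauss_poly_integrable)+
  also have "\<dots> = (LINT x|lborel. exp (- x\<^sup>2) * poly (pderiv (hermite n * q)) x
        - exp (- x\<^sup>2) * poly (pderiv (hermite n) * q) x)"
    by (rule Bochner_Integration.integral_diff[symmetric]) (rule gauss_poly_integrable)+
  also have "\<dots> = (LINT x|lborel. exp (- x\<^sup>2) * poly (hermite n * pderiv q) x)"
    by (intro Bochner_Integration.integral_cong refl) (simp add: pderiv_mult algebra_simps)
  also have "\<dots> = 0"
  proof (cases "degree q = 0")
    case True
    then show ?thesis using pderiv_eq_0_iff[of q] by simp
  next
    case False
    then show ?thesis using Suc.prems by (intro Suc.IH) (simp add: degree_pderiv)
  qed
  finally show ?case .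
qed simp

text \<open>Orthogonality for the weight \<open>exp (- x\<^sup>2)\<close> and leading coefficient
  \<open>2 ^ n\<close> (lemma \<open>degree_lead_coeff_hermite\<close>) identify \<open>hermite\<close> as the
  physicists' Hermite polynomials.\<close>

lemma hermite_orthogonal:
  assumes "m \<noteq> n"
  shows "(LINT x|lborel. exp (- x\<^sup>2) * poly (hermite m) x * poly (hermite n) x) = 0"
  using assms
proof (induction m n rule: linorder_wlog)
  case (le m n)
  then have "degree (hermite m) < n" using degree_lead_coeff_hermite[of m] by simp
  from hermite_orthogonal_lower[OF this] show ?case by (simp add: mult_ac)
next
  case (sym m n)
  then show ?case by (simp add: mult_ac)
qed

text \<open>Rows and columns are numbered from \<open>0\<close>, so \<open>\<alpha> 0, \<dots>, \<alpha> (N - 1)\<close> play the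
  role of \<open>\<alpha>\<^sub>1, \<dots>, \<alpha>\<^sub>N\<close>; the entries depend only on \<open>j - k\<close> and
  \<open>\<alpha>\<^sub>j / \<alpha>\<^sub>k\<close>.\<close>

definition L_mat :: "nat \<Rightarrow> (nat \<Rightarrow> real) \<Rightarrow> real \<Rightarrow> complex mat" where
  "L_mat N \<alpha> x = mat N N (\<lambda>(j, k).
     if k \<le> j
     then complex_of_real (poly (hermite (j - k)) x / fact (j - k) * (\<alpha> j / \<alpha> k))
     else 0)"

definition hermite_weight :: "nat \<Rightarrow> (nat \<Rightarrow> real) \<Rightarrow> real \<Rightarrow> complex mat" where
  "hermite_weight N \<alpha> x =
     complex_of_real (exp (- x\<^sup>2)) \<cdot>\<^sub>m (L_mat N \<alpha> x * mat_adjoint (L_mat N \<alpha> x))"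

text \<open>A matrix valued polynomial is a matrix with polynomial entries.\<close>

definition mat_poly_eval :: "complex poly mat \<Rightarrow> real \<Rightarrow> complex mat" where
  "mat_poly_eval P x = map_mat (\<lambda>p. poly p (complex_of_real x)) P"

definition monic_mat_poly :: "nat \<Rightarrow> nat \<Rightarrow> complex poly mat \<Rightarrow> bool" where
  "monic_mat_poly N n P \<longleftrightarrow> P \<in> carrier_mat N N \<and>
     (\<forall>i<N. \<forall>j<N. degree (P $$ (i, j)) \<le> n) \<and>
     map_mat (\<lambda>p. coeff p n) P = 1\<^sub>m N"

definition mv_inner ::
  "nat \<Rightarrow> (real \<Rightarrow> complex mat) \<Rightarrow> complex poly mat \<Rightarrow> complex poly mat \<Rightarrow> complex mat" where
  "mv_inner N W F G = mat N N (\<lambda>(i, j).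
     LINT y|lborel. (mat_poly_eval F y * W y * mat_adjoint (mat_poly_eval G y)) $$ (i, j))"

definition monic_mvops ::
  "nat \<Rightarrow> (real \<Rightarrow> complex mat) \<Rightarrow> (nat \<Rightarrow> complex poly mat) \<Rightarrow> bool" where
  "monic_mvops N W P \<longleftrightarrow>
     (\<forall>n. monic_mat_poly N n (P n)) \<and>
     (\<forall>n m. n \<noteq> m \<longrightarrow> mv_inner N W (P n) (P m) = 0\<^sub>m N N)"

definition sq_norm ::
  "nat \<Rightarrow> (real \<Rightarrow> complex mat) \<Rightarrow> (nat \<Rightarrow> complex poly mat) \<Rightarrow> nat \<Rightarrow> complex mat" where
  "sq_norm N W P n = mv_inner N W (P n) (P n)"

text \<open>The recurrence at \<open>n = 0\<close> contains the term \<open>P (0 - 1) = P 0\<close>, which is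
  annihilated by \<open>C 0 = 0\<close>.\<close>

definition three_term_coeffs ::
  "nat \<Rightarrow> (nat \<Rightarrow> complex poly mat) \<Rightarrow> (nat \<Rightarrow> complex mat) \<Rightarrow> (nat \<Rightarrow> complex mat) \<Rightarrow> bool" where
  "three_term_coeffs N P B C \<longleftrightarrow>
     (\<forall>n. B n \<in> carrier_mat N N \<and> C n \<in> carrier_mat N N) \<and>
     C 0 = 0\<^sub>m N N \<and>
     (\<forall>n x. complex_of_real x \<cdot>\<^sub>m mat_poly_eval (P n) x =
        mat_poly_eval (P (Suc n)) x + B n * mat_poly_eval (P n) x + C n * mat_poly_eval (P (n - 1)) x)"

end

theory Submission
  imports Defs
begin

text \<open>
  The weight has a second order differential operator that is symmetric for the matrix valued
  inner product and acts on the leading coefficient of a polynomial by a diagonal matrix with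
  distinct entries. Its existence comes from the factorisation \<open>W = exp (- x\<^sup>2) L L\<^sup>*\<close>: multiplying
  a row vector polynomial \<open>f\<close> by \<open>L\<close> turns the inner product into a sum of scalar Gaussian
  integrals, one for each column. On these the Hermite operator \<open>\<delta> p = p'' - 2 x p'\<close> is symmetric, and
  so is \<open>\<delta> - 2 k\<close> acting on column \<open>k\<close>. The shift \<open>2 k\<close> is chosen so that the result is again of
  the form \<open>(D f) L\<close>, with \<open>D\<close> not depending on \<open>k\<close> and not raising degrees: since \<open>\<delta> H\<^sub>n = - 2 n H\<^sub>n\<close> and
  \<open>H\<^sub>n\<^sub>+\<^sub>1' = 2 (n + 1) H\<^sub>n\<close>, the entries of \<open>L\<close> satisfy
  \<open>\<delta> L\<^sub>l\<^sub>k = - 2 (l - k) L\<^sub>l\<^sub>k\<close> and \<open>L\<^sub>l\<^sub>k' = 2 (\<alpha>\<^sub>l / \<alpha>\<^sub>l\<^sub>-\<^sub>1) L\<^sub>l\<^sub>-\<^sub>1\<^sub>k\<close>, so that, with indices starting at \<open>0\<close>,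
  \<open>(D f)\<^sub>l = f\<^sub>l'' - 2 x f\<^sub>l' - 2 l f\<^sub>l + 4 (\<alpha>\<^sub>l\<^sub>+\<^sub>1 / \<alpha>\<^sub>l) f\<^sub>l\<^sub>+\<^sub>1'\<close>
  (lemma \<open>times_L_row_op\<close>).

  Row \<open>i\<close> of \<open>P n\<close> has leading term \<open>x\<^sup>n\<close> in column \<open>i\<close> only, so \<open>D\<close> multiplies it by
  \<open>- 2 (n + i)\<close> up to terms of degree below \<open>n\<close>, which are orthogonal to all rows of \<open>P n\<close>.
  Symmetry of \<open>D\<close> then gives \<open>(n + i) \<H>(n)\<^sub>i\<^sub>j = (n + j) \<H>(n)\<^sub>i\<^sub>j\<close>, whence \<open>\<H>(n)\<close> is diagonal
  (lemma \<open>row_inner_diagonal\<close>).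

  For \<open>C(n)\<close>, pairing the recurrence with \<open>P(n - 1)\<close> gives \<open>C(n) \<H>(n - 1) = \<H>(n)\<close>. Both norms are
  diagonal and \<open>\<H>(n - 1)\<close> has nonzero diagonal entries because the weight is positive definite,
  so \<open>C(n)\<close> is diagonal (lemma \<open>recurrence_coefficient_diagonal\<close>).
\<close>

section \<open>The Gaussian functional on complex polynomials\<close>

definition gauss :: "complex poly \<Rightarrow> complex" where
  "gauss p = (LINT x|lborel. complex_of_real (exp (- x\<^sup>2)) * poly p (complex_of_real x))"

lemma gauss_monomial:
  "has_bochner_integral lborel
     (\<lambda>x. complex_of_real (exp (- x\<^sup>2)) * complex_of_real x ^ k) (complex_of_real (gauss_moment k))"
  using has_bochner_integral_of_real[OF gauss_moment[of k]] by simp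

lemma has_bochner_integral_gauss:
  "has_bochner_integral lborel
     (\<lambda>x. complex_of_real (exp (- x\<^sup>2)) * poly p (complex_of_real x)) (gauss p)"
proof -
  have "has_bochner_integral lborel
     (\<lambda>x. \<Sum>i\<le>degree p. coeff p i * (complex_of_real (exp (- x\<^sup>2)) * complex_of_real x ^ i))
     (\<Sum>i\<le>degree p. coeff p i * complex_of_real (gauss_moment i))"
    by (intro has_bochner_integral_sum has_bochner_integral_mult_right gauss_monomial)
  then have "has_bochner_integral lborel
     (\<lambda>x. complex_of_real (exp (- x\<^sup>2)) * poly p (complex_of_real x))
     (\<Sum>i\<le>degree p. coeff p i * complex_of_real (gauss_moment i))"
    by (simp add: poly_altdef sum_distrib_left mult_ac)
  then show ?thesis
    unfolding gauss_def by (simp add: has_bochner_integral_iff)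
qed

lemma gauss_add: "gauss (p + q) = gauss p + gauss q"
  using has_bochner_integral_integral_eq[OF has_bochner_integral_add[OF
      has_bochner_integral_gauss[of p] has_bochner_integral_gauss[of q]]]
  by (simp add: gauss_def distrib_left)

lemma gauss_smult: "gauss (Polynomial.smult c p) = c * gauss p"
  using has_bochner_integral_integral_eq[OF has_bochner_integral_mult_right[OF
      has_bochner_integral_gauss[of p], of c]]
  by (simp add: gauss_def mult_ac)

lemma gauss_0: "gauss 0 = 0"
  by (simp add: gauss_def)

lemma gauss_diff: "gauss (p - q) = gauss p - gauss q"
  using gauss_add[of "p - q" q] by simp

lemma gauss_of_sum: "gauss (\<Sum>i\<in>A. f i) = (\<Sum>i\<in>A. gauss (f i))"
  by (induction A rule: infinite_finite_induct) (simp_all add: gauss_add gauss_0)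

lemma gauss_monom: "gauss (monom c k) = c * complex_of_real (gauss_moment k)"
  using has_bochner_integral_integral_eq[OF has_bochner_integral_mult_right[OF gauss_monomial[of k], of c]]
  by (simp add: gauss_def poly_monom mult_ac)

lemma gauss_cnj: "gauss (map_poly cnj p) = cnj (gauss p)"
proof -
  have "cnj (gauss p) =
      (LINT x|lborel. cnj (complex_of_real (exp (- x\<^sup>2)) * poly p (complex_of_real x)))"
    unfolding gauss_def by (rule Bochner_Integration.integral_cnj[symmetric])
  then show ?thesis
    by (simp add: gauss_def)
qed

text \<open>On a monomial this is the two-step recursion of the Gaussian moments.\<close>

lemma gauss_integration_by_parts: "gauss ([:0, 2:] * p) = gauss (pderiv p)"
proof -
  have monomial: "gauss ([:0, 2:] * monom c k) = gauss (pderiv (monom c k))" for c k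
  proof -
    have "[:0, 2:] * monom c k = monom (2 * c) (Suc k)"
      by (simp add: monom_Suc smult_monom)
    moreover have "complex_of_real (2 * gauss_moment (Suc k)) =
        complex_of_real (of_nat k * gauss_moment (k - 1))"
      by (simp only: gauss_moment_rec)
    ultimately show ?thesis
      by (simp add: gauss_monom pderiv_monom mult_ac)
  qed
  have "gauss ([:0, 2:] * (\<Sum>i\<le>degree p. monom (coeff p i) i)) =
      gauss (pderiv (\<Sum>i\<le>degree p. monom (coeff p i) i))"
    unfolding sum_distrib_left gauss_of_sum pderiv_sum monomial ..
  then show ?thesis
    by (simp only: poly_as_sum_of_monoms)
qed

lemma cnj_poly_diff: "map_poly cnj (p - q) = map_poly cnj p - map_poly cnj q"
  and cnj_poly_smult: "map_poly cnj (Polynomial.smult c p) = Polynomial.smult (cnj c) (map_poly cnj p)"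
  by (simp_all add: poly_eq_iff coeff_map_poly)

lemma cnj_poly_mult: "map_poly cnj (p * q) = map_poly cnj p * map_poly cnj q"
  by (simp add: poly_eq_iff coeff_map_poly coeff_mult)

lemma cnj_cnj_poly: "map_poly cnj (map_poly cnj p) = p"
  by (simp add: poly_eq_iff coeff_map_poly)

lemma gauss_self:
  "gauss (p * map_poly cnj p) =
     complex_of_real (LINT x|lborel. exp (- x\<^sup>2) * (cmod (poly p (complex_of_real x)))\<^sup>2)"
  unfolding gauss_def
  by (simp flip: integral_complex_of_real complex_norm_square)

lemma gauss_self_integrable:
  "integrable lborel (\<lambda>x. exp (- x\<^sup>2) * (cmod (poly p (complex_of_real x)))\<^sup>2)"
proof -
  have "integrable lborel (\<lambda>x. complex_of_real (exp (- x\<^sup>2)) * poly (p * map_poly cnj p) (complex_of_real x))"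
    using has_bochner_integral_gauss by (rule integrable.intros)
  then have "integrable lborel
      (\<lambda>x. complex_of_real (exp (- x\<^sup>2) * (cmod (poly p (complex_of_real x)))\<^sup>2))"
    by (simp flip: complex_norm_square)
  then show ?thesis
    unfolding complex_of_real_integrable_eq .
qed

lemma gauss_self_nonneg: "0 \<le> Re (gauss (p * map_poly cnj p))"
  unfolding gauss_self by simp

text \<open>The integrand is nonnegative, so a vanishing integral forces it to vanish almost
  everywhere; a nonzero polynomial has only finitely many roots, which is a null set.\<close>

lemma gauss_self_eq_0:
  assumes "gauss (p * map_poly cnj p) = 0"
  shows "p = 0"
proof (rule ccontr)
  assume "p \<noteq> 0"
  have "(LINT x|lborel. exp (- x\<^sup>2) * (cmod (poly p (complex_of_real x)))\<^sup>2) = 0"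
    using assms unfolding gauss_self by simp
  then have zero: "AE x in lborel. poly p (complex_of_real x) = 0"
    by (subst (asm) integral_nonneg_eq_0_iff_AE[OF gauss_self_integrable]) auto
  have "finite (complex_of_real -` {z. poly p z = 0})"
    using \<open>p \<noteq> 0\<close> by (intro finite_vimageI poly_roots_finite) (auto intro: inj_of_real)
  then have "{x. poly p (complex_of_real x) = 0} \<in> null_sets lborel"
    by (intro finite_imp_null_set_lborel) (simp add: vimage_def)
  from AE_not_in[OF this] zero have "AE x::real in lborel. False"
    by eventually_elim simp
  then have "emeasure lborel (UNIV :: real set) = 0"
    by (simp add: eventually_False ae_filter_eq_bot_iff)
  then show False
    by simp
qed

section \<open>The scalar Hermite operator\<close>

definition hermite_op :: "'a::idom poly \<Rightarrow> 'a poly" where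
  "hermite_op p = pderiv (pderiv p) - [:0, 2:] * pderiv p"

lemma hermite_op_add: "hermite_op (p + q) = hermite_op p + hermite_op q"
  and hermite_op_smult: "hermite_op (Polynomial.smult c p) = Polynomial.smult c (hermite_op p)"
  by (simp_all add: hermite_op_def pderiv_add pderiv_smult algebra_simps smult_diff_right smult_add_right)

lemma hermite_op_0: "hermite_op 0 = 0"
  by (simp add: hermite_op_def)

lemma hermite_op_sum: "hermite_op (\<Sum>i\<in>A. f i) = (\<Sum>i\<in>A. hermite_op (f i))"
  by (induction A rule: infinite_finite_induct) (simp_all add: hermite_op_add hermite_op_0)

lemma hermite_op_mult:
  "hermite_op (p * q) = hermite_op p * q + Polynomial.smult 2 (pderiv p * pderiv q) + p * hermite_op q"
proof -
  have "Polynomial.smult 2 r = r + r" for r :: "'a poly"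
    using smult_add_left[of 1 1 r] by simp
  then show ?thesis
    unfolding hermite_op_def by (simp add: pderiv_mult pderiv_add algebra_simps)
qed

text \<open>The Hermite differential equation, obtained by differentiating \<open>H\<^sub>n\<^sub>+\<^sub>1 = 2 x H\<^sub>n - H\<^sub>n'\<close> and
  replacing \<open>H\<^sub>n\<^sub>+\<^sub>1'\<close> by \<open>2 (n + 1) H\<^sub>n\<close>.\<close>

lemma hermite_op_hermite:
  "hermite_op (hermite n) = Polynomial.smult (- 2 * of_nat n) (hermite n)"
proof -
  have "pderiv (hermite (Suc n)) =
      Polynomial.smult 2 (hermite n) + [:0, 2:] * pderiv (hermite n) - pderiv (pderiv (hermite n))"
    unfolding hermite_Suc pderiv_diff pderiv_mult by (simp add: pderiv_pCons algebra_simps)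
  then have "hermite_op (hermite n) =
      Polynomial.smult 2 (hermite n) - Polynomial.smult (2 * of_nat (Suc n)) (hermite n)"
    unfolding hermite_op_def pderiv_hermite by (simp add: algebra_simps)
  then show ?thesis
    by (simp flip: smult_diff_left)
qed

lemma pderiv_of_real: "pderiv (map_poly complex_of_real p) = map_poly complex_of_real (pderiv p)"
  by (simp add: poly_eq_iff coeff_map_poly coeff_pderiv)

lemma of_real_smult: "map_poly complex_of_real (Polynomial.smult c p) =
  Polynomial.smult (complex_of_real c) (map_poly complex_of_real p)"
  by (simp add: poly_eq_iff coeff_map_poly)

lemma hermite_op_of_real: "hermite_op (map_poly complex_of_real p) = map_poly complex_of_real (hermite_op p)"
  by (simp add: poly_eq_iff hermite_op_def coeff_map_poly coeff_pderiv coeff_pCons split: nat.split)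

lemma cnj_poly_hermite_op: "map_poly cnj (hermite_op p) = hermite_op (map_poly cnj p)"
  by (simp add: poly_eq_iff hermite_op_def coeff_map_poly coeff_pderiv coeff_pCons split: nat.split)

text \<open>This is the weighted form of \<open>\<delta> p = exp (x\<^sup>2) (exp (- x\<^sup>2) p')'\<close>. The right-hand side is
  symmetric in \<open>p\<close> and \<open>q\<close>, which gives the symmetry of the operator below.\<close>

lemma gauss_hermite_op: "gauss (hermite_op p * q) = - gauss (pderiv p * pderiv q)"
proof -
  have "gauss (hermite_op p * q) = gauss (pderiv (pderiv p) * q) - gauss ([:0, 2:] * (pderiv p * q))"
    by (simp add: hermite_op_def gauss_diff[symmetric] algebra_simps)
  also have "gauss ([:0, 2:] * (pderiv p * q)) = gauss (pderiv (pderiv p) * q) + gauss (pderiv p * pderiv q)"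
    unfolding gauss_integration_by_parts by (simp add: pderiv_mult gauss_add[symmetric] algebra_simps)
  finally show ?thesis by simp
qed

lemma hermite_op_symmetric: "gauss (hermite_op p * q) = gauss (p * hermite_op q)"
  using gauss_hermite_op[of p q] gauss_hermite_op[of q p] by (simp add: mult.commute)

section \<open>Row vectors of polynomials\<close>

text \<open>A row vector polynomial is a function on indices of which only the values below \<open>N\<close> matter.
  Working with rows replaces matrix algebra by finite sums of scalar integrals.\<close>

locale hermite_rows =
  fixes N :: nat and \<alpha> :: "nat \<Rightarrow> real"
  assumes \<alpha>_pos: "\<And>i. i < N \<Longrightarrow> 0 < \<alpha> i"
begin

text \<open>Polynomials whose values at real points are the entries of the matrix \<open>L\<close>.\<close>

definition L_poly :: "nat \<Rightarrow> nat \<Rightarrow> complex poly" where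
  "L_poly l k = (if k \<le> l
     then Polynomial.smult (complex_of_real (\<alpha> l / \<alpha> k / fact (l - k))) (map_poly complex_of_real (hermite (l - k)))
     else 0)"

definition times_L :: "(nat \<Rightarrow> complex poly) \<Rightarrow> nat \<Rightarrow> complex poly" where
  "times_L f k = (\<Sum>l<N. f l * L_poly l k)"

definition row_inner :: "(nat \<Rightarrow> complex poly) \<Rightarrow> (nat \<Rightarrow> complex poly) \<Rightarrow> complex" where
  "row_inner f h = (\<Sum>k<N. gauss (times_L f k * map_poly cnj (times_L h k)))"

lemma poly_L_poly:
  "l < N \<Longrightarrow> k < N \<Longrightarrow> poly (L_poly l k) (complex_of_real x) = L_mat N \<alpha> x $$ (l, k)"
  by (simp add: L_poly_def L_mat_def of_real_hom.poly_map_poly mult_ac)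

text \<open>Reassociating \<open>F W G\<^sup>* = exp (- x\<^sup>2) (F L) (G L)\<^sup>*\<close> reduces each entry to scalar Gaussian
  integrals of polynomials.\<close>

lemma mv_inner_eq_row_inner:
  assumes F: "F \<in> carrier_mat N N" and G: "G \<in> carrier_mat N N" and i: "i < N" and j: "j < N"
  shows "mv_inner N (hermite_weight N \<alpha>) F G $$ (i, j) = row_inner (\<lambda>l. F $$ (i, l)) (\<lambda>l. G $$ (j, l))"
proof -
  let ?f = "\<lambda>l. F $$ (i, l)" and ?h = "\<lambda>l. G $$ (j, l)"
  have integrand: "(mat_poly_eval F y * hermite_weight N \<alpha> y * mat_adjoint (mat_poly_eval G y)) $$ (i, j) =
      (\<Sum>k<N. complex_of_real (exp (- y\<^sup>2)) *
        poly (times_L ?f k * map_poly cnj (times_L ?h k)) (complex_of_real y))" for y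
  proof -
    define E where "E = mat_poly_eval F y"
    define K where "K = mat_adjoint (mat_poly_eval G y)"
    define M where "M = L_mat N \<alpha> y"
    define M' where "M' = mat_adjoint M"
    define c where "c = complex_of_real (exp (- y\<^sup>2))"
    have M: "M \<in> carrier_mat N N" by (simp add: M_def L_mat_def)
    have E: "E \<in> carrier_mat N N" using F by (simp add: E_def mat_poly_eval_def)
    have G': "mat_poly_eval G y \<in> carrier_mat N N" using G by (simp add: mat_poly_eval_def)
    have adj: "mat_adjoint A \<in> carrier_mat N N" "s < N \<Longrightarrow> t < N \<Longrightarrow> mat_adjoint A $$ (s, t) = cnj (A $$ (t, s))"
      if "A \<in> carrier_mat N N" for A :: "complex mat" and s t
      using that by (auto simp: mat_adjoint_def mat_of_rows_def)
    have K: "K \<in> carrier_mat N N" using adj(1)[OF G'] by (simp add: K_def)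
    have M': "M' \<in> carrier_mat N N" using adj(1)[OF M] by (simp add: M'_def)
    have "E * (c \<cdot>\<^sub>m (M * M')) * K = c \<cdot>\<^sub>m ((E * M) * (M' * K))"
      using E M M' K
      by (simp add: mult_smult_distrib[where nr = N and n = N and nc = N]
          mult_smult_assoc_mat[where nr = N and n = N and nc = N]
          assoc_mult_mat[where n\<^sub>1 = N and n\<^sub>2 = N and n\<^sub>3 = N and n\<^sub>4 = N])
    then have "(E * (c \<cdot>\<^sub>m (M * M')) * K) $$ (i, j) = c * (\<Sum>k<N. (E * M) $$ (i, k) * (M' * K) $$ (k, j))"
      using E M M' K i j by (simp add: scalar_prod_def atLeast0LessThan)
    also have "(\<Sum>k<N. (E * M) $$ (i, k) * (M' * K) $$ (k, j)) =
        (\<Sum>k<N. poly (times_L ?f k) (complex_of_real y) * cnj (poly (times_L ?h k) (complex_of_real y)))"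
    proof (intro sum.cong refl arg_cong2[where f = "(*)"])
      fix k assume k: "k \<in> {..<N}"
      show "(E * M) $$ (i, k) = poly (times_L ?f k) (complex_of_real y)"
        using E M k i F
        by (simp add: scalar_prod_def atLeast0LessThan times_L_def poly_sum poly_L_poly M_def E_def
            mat_poly_eval_def)
      show "(M' * K) $$ (k, j) = cnj (poly (times_L ?h k) (complex_of_real y))"
        using K M' k j G adj(2)[OF M] adj(2)[OF G']
        by (simp add: scalar_prod_def atLeast0LessThan times_L_def poly_sum poly_L_poly M_def[symmetric]
            K_def M'_def mat_poly_eval_def mult.commute)
    qed
    finally show ?thesis
      by (simp add: E_def K_def M_def M'_def c_def hermite_weight_def sum_distrib_left)
  qed
  have "mv_inner N (hermite_weight N \<alpha>) F G $$ (i, j) =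
      (LINT y|lborel. (\<Sum>k<N. complex_of_real (exp (- y\<^sup>2)) *
        poly (times_L ?f k * map_poly cnj (times_L ?h k)) (complex_of_real y)))"
    using i j by (simp only: mv_inner_def integrand index_mat case_prod_conv)
  also have "\<dots> = row_inner ?f ?h"
    unfolding row_inner_def
    by (intro has_bochner_integral_integral_eq has_bochner_integral_sum has_bochner_integral_gauss)
  finally show ?thesis .
qed

lemma times_L_cong: "(\<And>l. l < N \<Longrightarrow> f l = g l) \<Longrightarrow> times_L f k = times_L g k"
  by (simp add: times_L_def)

lemma row_inner_cong: "(\<And>l. l < N \<Longrightarrow> f l = g l) \<Longrightarrow> row_inner f h = row_inner g h"
  using times_L_cong[of f g] by (simp add: row_inner_def)

lemma times_L_add: "times_L (\<lambda>l. f l + g l) k = times_L f k + times_L g k"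
  by (simp add: times_L_def distrib_right sum.distrib)

lemma times_L_mult: "times_L (\<lambda>l. p * f l) k = p * times_L f k"
  by (simp add: times_L_def sum_distrib_left mult.assoc)

lemma times_L_smult: "times_L (\<lambda>l. Polynomial.smult c (f l)) k = Polynomial.smult c (times_L f k)"
  using times_L_mult[of "[:c:]" f k] by simp

lemma row_inner_0: "row_inner (\<lambda>l. 0) h = 0"
  by (simp add: row_inner_def times_L_def gauss_0)

lemma row_inner_add: "row_inner (\<lambda>l. f l + g l) h = row_inner f h + row_inner g h"
  by (simp add: row_inner_def times_L_add distrib_right gauss_add sum.distrib)

lemma row_inner_smult: "row_inner (\<lambda>l. Polynomial.smult c (f l)) h = c * row_inner f h"
  by (simp add: row_inner_def times_L_smult gauss_smult sum_distrib_left)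

lemma row_inner_sum: "row_inner (\<lambda>l. \<Sum>s\<in>S. f s l) h = (\<Sum>s\<in>S. row_inner (f s) h)"
  by (induction S rule: infinite_finite_induct) (simp_all add: row_inner_0 row_inner_add)

lemma cnj_row_inner: "cnj (row_inner f h) = row_inner h f"
  by (simp add: row_inner_def cnj_poly_mult cnj_cnj_poly mult.commute flip: gauss_cnj)

lemma row_inner_mult_X: "row_inner (\<lambda>l. [:0, 1:] * f l) h = row_inner f (\<lambda>l. [:0, 1:] * h l)"
proof -
  have "map_poly cnj [:0, 1:] = [:0, 1:]"
    by (simp add: map_poly_pCons)
  then show ?thesis
    unfolding row_inner_def times_L_mult cnj_poly_mult by (simp only: mult_ac)
qed

text \<open>The matrix \<open>L\<close> is lower triangular with ones on the diagonal, so back substitution from the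
  last column recovers \<open>f\<close>.\<close>

lemma times_L_eq_0_imp_eq_0:
  assumes "\<And>k. k < N \<Longrightarrow> times_L f k = 0" and "l < N"
  shows "f l = 0"
  using assms(2)
proof (induction "N - l" arbitrary: l rule: less_induct)
  case less
  have "times_L f l = f l * L_poly l l + (\<Sum>s\<in>{..<N} - {l}. f s * L_poly s l)"
    unfolding times_L_def using less.prems by (subst sum.remove[of _ l]) auto
  also have "(\<Sum>s\<in>{..<N} - {l}. f s * L_poly s l) = 0"
  proof (intro sum.neutral ballI)
    fix s assume s: "s \<in> {..<N} - {l}"
    then show "f s * L_poly s l = 0"
      using less.hyps[of s] by (cases "l \<le> s") (auto simp: L_poly_def)
  qed
  finally show ?case
    using assms(1)[OF less.prems] \<alpha>_pos[OF less.prems] by (simp add: L_poly_def)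
qed

lemma row_inner_self_eq_0:
  assumes "row_inner f f = 0" and "l < N"
  shows "f l = 0"
proof (rule times_L_eq_0_imp_eq_0)
  fix k assume k: "k < N"
  have "(\<Sum>k<N. Re (gauss (times_L f k * map_poly cnj (times_L f k)))) = 0"
    using assms(1) unfolding row_inner_def by (simp flip: Re_sum)
  then have "Re (gauss (times_L f k * map_poly cnj (times_L f k))) = 0"
    using k by (subst (asm) sum_nonneg_eq_0_iff) (auto simp: gauss_self_nonneg)
  then show "times_L f k = 0"
    by (intro gauss_self_eq_0) (simp add: gauss_self)
qed (rule assms(2))

section \<open>The matrix differential operator\<close>

text \<open>The operator \<open>\<delta> - 2 k\<close> on the columns of \<open>f L\<close>, transported to \<open>f\<close>. The conditional drops
  the term that refers to the column after the last one.\<close>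

definition row_op :: "(nat \<Rightarrow> complex poly) \<Rightarrow> nat \<Rightarrow> complex poly" where
  "row_op f l = hermite_op (f l) - Polynomial.smult (2 * of_nat l) (f l) +
     (if Suc l < N then Polynomial.smult (complex_of_real (4 * \<alpha> (Suc l) / \<alpha> l)) (pderiv (f (Suc l))) else 0)"

lemma hermite_op_L_poly: "hermite_op (L_poly l k) =
    Polynomial.smult (2 * of_nat k - 2 * of_nat l) (L_poly l k)"
  by (simp add: L_poly_def hermite_op_smult hermite_op_of_real hermite_op_hermite of_real_smult hermite_op_0
      of_nat_diff algebra_simps)

lemma pderiv_L_poly_0: "pderiv (L_poly 0 k) = 0"
  by (simp add: L_poly_def pderiv_smult pderiv_of_real)

lemma pderiv_L_poly_Suc:
  assumes "Suc l < N"
  shows "pderiv (L_poly (Suc l) k) = Polynomial.smult (complex_of_real (2 * \<alpha> (Suc l) / \<alpha> l)) (L_poly l k)"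
proof (cases "k \<le> l")
  case True
  have "\<alpha> l \<noteq> 0" using \<alpha>_pos[of l] assms by simp
  have "Suc l - k = Suc (l - k)" using True by simp
  then have "pderiv (L_poly (Suc l) k) =
      Polynomial.smult (complex_of_real (\<alpha> (Suc l) / \<alpha> k / fact (Suc (l - k)) * (2 * of_nat (Suc (l - k)))))
        (map_poly complex_of_real (hermite (l - k)))"
    using True unfolding L_poly_def
    by (simp only: pderiv_smult pderiv_of_real pderiv_hermite of_real_smult le_SucI if_True smult_smult of_real_mult)
  also have "\<alpha> (Suc l) / \<alpha> k / fact (Suc (l - k)) * (2 * of_nat (Suc (l - k))) =
      2 * \<alpha> (Suc l) / \<alpha> l * (\<alpha> l / \<alpha> k / fact (l - k))"
    using \<open>\<alpha> l \<noteq> 0\<close> by (simp del: of_nat_Suc add: field_simps)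
  finally show ?thesis
    using True by (simp add: L_poly_def)
next
  case False
  then show ?thesis by (cases "k = Suc l") (simp_all add: L_poly_def pderiv_smult pderiv_of_real)
qed

text \<open>In the product rule for \<open>\<delta> (f\<^sub>l L\<^sub>l\<^sub>k)\<close> the term \<open>f\<^sub>l \<delta> L\<^sub>l\<^sub>k\<close> contributes the eigenvalue
  \<open>2 k - 2 l\<close>, whose part \<open>2 k\<close> is cancelled by the shift. The cross term \<open>2 f\<^sub>l' L\<^sub>l\<^sub>k'\<close> is a
  multiple of \<open>f\<^sub>l' L\<^sub>l\<^sub>-\<^sub>1\<^sub>k\<close>, so after shifting the summation index it again has the form of a row
  multiplied by \<open>L\<close>.\<close>

lemma times_L_row_op:
  "times_L (row_op f) k = hermite_op (times_L f k) - Polynomial.smult (2 * of_nat k) (times_L f k)"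
proof -
  have shift: "(\<Sum>l<N. (if Suc l < N
        then Polynomial.smult (complex_of_real (4 * \<alpha> (Suc l) / \<alpha> l)) (pderiv (f (Suc l))) else 0) * L_poly l k) =
      (\<Sum>l<N. Polynomial.smult 2 (pderiv (f l) * pderiv (L_poly l k)))"
  proof (cases N)
    case (Suc M)
    have "Polynomial.smult (complex_of_real (4 * \<alpha> (Suc l) / \<alpha> l)) (pderiv (f (Suc l))) * L_poly l k =
        Polynomial.smult 2 (pderiv (f (Suc l)) * pderiv (L_poly (Suc l) k))" if "l < M" for l
      using that Suc by (simp add: pderiv_L_poly_Suc)
    then show ?thesis
      unfolding Suc by (subst (2) sum.lessThan_Suc_shift) (simp add: pderiv_L_poly_0)
  qed simp
  have "hermite_op (times_L f k) - Polynomial.smult (2 * of_nat k) (times_L f k) =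
     (\<Sum>l<N. hermite_op (f l) * L_poly l k) + (\<Sum>l<N. Polynomial.smult 2 (pderiv (f l) * pderiv (L_poly l k)))
     + (\<Sum>l<N. Polynomial.smult (2 * of_nat k - 2 * of_nat l) (f l * L_poly l k)
         - Polynomial.smult (2 * of_nat k) (f l * L_poly l k))"
    unfolding times_L_def hermite_op_sum hermite_op_mult sum.distrib sum_subtractf hermite_op_L_poly
    by (simp add: smult_sum2)
  also have "\<dots> = times_L (row_op f) k"
    unfolding shift[symmetric] times_L_def sum.distrib[symmetric]
    by (intro sum.cong refl) (simp add: row_op_def algebra_simps smult_diff_left)
  finally show ?thesis ..
qed

text \<open>After multiplication by \<open>L\<close>, the operator acts on each column as the symmetric Hermite operator
  minus a real scalar.\<close>

lemma row_op_symmetric: "row_inner (row_op f) h = row_inner f (row_op h)"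
  by (simp add: row_inner_def times_L_row_op cnj_poly_diff cnj_poly_smult cnj_poly_hermite_op
      left_diff_distrib right_diff_distrib gauss_diff gauss_smult hermite_op_symmetric)

text \<open>Stated through coefficients, so that \<open>n = 0\<close> describes exactly the zero row, which a bound
  on \<open>degree\<close> cannot do.\<close>

definition deg_below :: "nat \<Rightarrow> (nat \<Rightarrow> complex poly) \<Rightarrow> bool" where
  "deg_below n f \<longleftrightarrow> (\<forall>l<N. \<forall>m\<ge>n. coeff (f l) m = 0)"

end

section \<open>Monic matrix valued orthogonal polynomials\<close>

locale hermite_mvops = hermite_rows +
  fixes P :: "nat \<Rightarrow> complex poly mat"
  assumes mvops: "monic_mvops N (hermite_weight N \<alpha>) P"
begin

definition P_row :: "nat \<Rightarrow> nat \<Rightarrow> nat \<Rightarrow> complex poly" where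
  "P_row n i l = P n $$ (i, l)"

lemma P_carrier: "P n \<in> carrier_mat N N"
  using mvops by (auto simp: monic_mvops_def monic_mat_poly_def)

lemma coeff_row_lead: "i < N \<Longrightarrow> l < N \<Longrightarrow> coeff (P_row n i l) n = (if i = l then 1 else 0)"
proof -
  assume il: "i < N" "l < N"
  have "map_mat (\<lambda>p. coeff p n) (P n) $$ (i, l) = 1\<^sub>m N $$ (i, l)"
    using mvops by (simp add: monic_mvops_def monic_mat_poly_def)
  then show ?thesis
    using il P_carrier[of n] by (simp add: P_row_def)
qed

lemma coeff_row_above: "i < N \<Longrightarrow> l < N \<Longrightarrow> n < m \<Longrightarrow> coeff (P_row n i l) m = 0"
  using mvops unfolding monic_mvops_def monic_mat_poly_def P_row_def
  by (meson coeff_eq_0 le_less_trans)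

lemma sq_norm_eq_row_inner:
  "i < N \<Longrightarrow> j < N \<Longrightarrow> sq_norm N (hermite_weight N \<alpha>) P n $$ (i, j) = row_inner (P_row n i) (P_row n j)"
  unfolding sq_norm_def P_row_def by (rule mv_inner_eq_row_inner[OF P_carrier P_carrier])

lemma rows_orthogonal:
  "n \<noteq> m \<Longrightarrow> i < N \<Longrightarrow> j < N \<Longrightarrow> row_inner (P_row n i) (P_row m j) = 0"
  using mvops unfolding P_row_def mv_inner_eq_row_inner[OF P_carrier P_carrier, symmetric]
  by (simp add: monic_mvops_def)

text \<open>Since \<open>P k\<close> is monic, subtracting a combination of its rows removes the degree \<open>k\<close> part of
  a row; each subtracted row is orthogonal to the rows of \<open>P n\<close> when \<open>k < n\<close>.\<close>

lemma row_orthogonal_to_lower_degree: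
  "deg_below k f \<Longrightarrow> k \<le> n \<Longrightarrow> j < N \<Longrightarrow> row_inner f (P_row n j) = 0"
proof (induction k arbitrary: f)
  case 0
  then have "row_inner f (P_row n j) = row_inner (\<lambda>l. 0) (P_row n j)"
    by (intro row_inner_cong) (simp add: deg_below_def poly_eq_iff)
  then show ?case by (simp add: row_inner_0)
next
  case (Suc k)
  define t where "t l = (\<Sum>i<N. Polynomial.smult (coeff (f i) k) (P_row k i l))" for l
  define g where "g l = f l + Polynomial.smult (- 1) (t l)" for l
  have "deg_below k g"
    unfolding deg_below_def
  proof (intro allI impI)
    fix l m assume l: "l < N" and m: "k \<le> m"
    show "coeff (g l) m = 0"
    proof (cases "m = k")
      case True
      have "coeff (t l) m = (\<Sum>i<N. coeff (f i) k * (if i = l then 1 else 0))"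
        unfolding t_def coeff_sum True using l by (intro sum.cong) (auto simp: coeff_row_lead)
      then show ?thesis using l True by (simp add: g_def if_distrib cong: if_cong)
    next
      case False
      then show ?thesis
        using Suc.prems(1) l m by (simp add: g_def t_def coeff_sum coeff_row_above deg_below_def)
    qed
  qed
  then have "row_inner g (P_row n j) = 0"
    using Suc.prems by (intro Suc.IH) simp_all
  moreover have "row_inner t (P_row n j) = 0"
    unfolding t_def row_inner_sum row_inner_smult
    using Suc.prems by (intro sum.neutral) (simp add: rows_orthogonal)
  moreover have "row_inner g (P_row n j) = row_inner f (P_row n j) + (- 1) * row_inner t (P_row n j)"
    unfolding g_def row_inner_add row_inner_smult ..
  ultimately show ?case by simp
qed

text \<open>On the coefficient of degree \<open>n\<close> the terms \<open>f\<^sub>l''\<close> and \<open>f\<^sub>l\<^sub>+\<^sub>1'\<close> of the operator do not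
  contribute, \<open>- 2 x f\<^sub>l'\<close> gives \<open>- 2 n\<close> and the zeroth order term gives \<open>- 2 l\<close>, with \<open>l = i\<close> the
  only column that has such a coefficient. The remainder has lower degree.\<close>

lemma row_op_P_row:
  assumes "i < N" and "j < N"
  shows "row_inner (row_op (P_row n i)) (P_row n j) = - 2 * of_nat (n + i) * row_inner (P_row n i) (P_row n j)"
proof -
  define r where "r l = row_op (P_row n i) l + Polynomial.smult (2 * of_nat (n + i)) (P_row n i l)" for l
  have "deg_below n r"
    unfolding deg_below_def
  proof (intro allI impI)
    fix l m assume l: "l < N" and m: "n \<le> m"
    have "coeff (pderiv (P_row n i s)) m = 0" if "s < N" for s
      using m assms(1) that by (simp add: coeff_pderiv coeff_row_above)
    moreover have "coeff (pderiv (pderiv (P_row n i l))) m = 0"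
      using m assms(1) l by (simp add: coeff_pderiv coeff_row_above)
    moreover have "coeff ([:0, 2:] * pderiv (P_row n i l)) m = 2 * of_nat m * coeff (P_row n i l) m"
      by (cases m) (simp_all add: coeff_pderiv)
    ultimately have "coeff (r l) m = (2 * of_nat (n + i) - 2 * of_nat (m + l)) * coeff (P_row n i l) m"
      using l by (simp add: r_def row_op_def hermite_op_def algebra_simps)
    then show "coeff (r l) m = 0"
      using m assms(1) l by (cases "m = n") (auto simp: coeff_row_lead coeff_row_above)
  qed
  then have "row_inner r (P_row n j) = 0"
    using assms(2) by (rule row_orthogonal_to_lower_degree[OF _ order_refl])
  then show ?thesis
    unfolding r_def row_inner_add row_inner_smult by (simp add: add_eq_0_iff2 algebra_simps)
qed

text \<open>Moving the symmetric operator from one factor to the other compares the eigenvalues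
  \<open>- 2 (n + i)\<close> and \<open>- 2 (n + j)\<close>, which are distinct and real.\<close>

lemma row_inner_diagonal:
  assumes "i < N" and "j < N" and "i \<noteq> j"
  shows "row_inner (P_row n i) (P_row n j) = 0"
proof -
  let ?X = "row_inner (P_row n i) (P_row n j)"
  have "- 2 * of_nat (n + i) * ?X = row_inner (P_row n i) (row_op (P_row n j))"
    using row_op_P_row[OF assms(1,2)] by (simp only: row_op_symmetric)
  also have "\<dots> = cnj (- 2 * of_nat (n + j) * row_inner (P_row n j) (P_row n i))"
    by (simp only: cnj_row_inner flip: row_op_P_row[OF assms(2,1)])
  also have "\<dots> = - 2 * of_nat (n + j) * ?X"
    by (simp add: cnj_row_inner)
  finally have "(of_nat i - of_nat j :: complex) * ?X = 0"
    by (simp add: algebra_simps)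
  then show ?thesis
    using assms(3) by simp
qed

lemma row_inner_self_nonzero: "i < N \<Longrightarrow> row_inner (P_row n i) (P_row n i) \<noteq> 0"
  using row_inner_self_eq_0[of "P_row n i" i] coeff_row_lead[of i i n] by auto

text \<open>Row \<open>j\<close> of \<open>x P n\<close> and of \<open>P (n + 1)\<close> differ by terms of degree at most \<open>n\<close>.\<close>

lemma row_inner_X_mult:
  assumes "i < N" and "j < N"
  shows "row_inner (P_row (Suc n) i) (\<lambda>l. [:0, 1:] * P_row n j l) = row_inner (P_row (Suc n) i) (P_row (Suc n) j)"
proof -
  define r where "r l = [:0, 1:] * P_row n j l + Polynomial.smult (- 1) (P_row (Suc n) j l)" for l
  have "deg_below (Suc n) r"
    unfolding deg_below_def
  proof (intro allI impI)
    fix l m assume "l < N" "Suc n \<le> m"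
    moreover from this obtain k where "m = Suc k" "n \<le> k" by (cases m) auto
    ultimately show "coeff (r l) m = 0"
      using assms(2) by (cases "k = n") (auto simp: r_def coeff_row_lead coeff_row_above)
  qed
  then have "row_inner r (P_row (Suc n) i) = 0"
    using assms(1) by (rule row_orthogonal_to_lower_degree[OF _ order_refl])
  then have "row_inner (\<lambda>l. [:0, 1:] * P_row n j l) (P_row (Suc n) i) = row_inner (P_row (Suc n) j) (P_row (Suc n) i)"
    unfolding r_def row_inner_add row_inner_smult by simp
  then show ?thesis
    by (metis cnj_row_inner)
qed

text \<open>The recurrence is given for values at real points; these are infinitely many, so it holds
  for the polynomials themselves.\<close>

lemma recurrence_rows:
  assumes rec: "three_term_coeffs N P B C" and i: "i < N" and l: "l < N"
  shows "[:0, 1:] * P_row (Suc n) i l = P_row (Suc (Suc n)) i l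
     + (\<Sum>s<N. Polynomial.smult (B (Suc n) $$ (i, s)) (P_row (Suc n) s l))
     + (\<Sum>s<N. Polynomial.smult (C (Suc n) $$ (i, s)) (P_row n s l))"
    (is "?p = ?q")
proof -
  have BC: "B (Suc n) \<in> carrier_mat N N" "C (Suc n) \<in> carrier_mat N N"
    using rec by (auto simp: three_term_coeffs_def)
  have carrier: "mat_poly_eval (P m) x \<in> carrier_mat N N" for m x
    using P_carrier[of m] by (simp add: mat_poly_eval_def)
  have entry: "mat_poly_eval (P m) x $$ (s, l) = poly (P_row m s l) (complex_of_real x)" if "s < N" for m x s
    using P_carrier[of m] that l by (simp add: mat_poly_eval_def P_row_def)
  have "poly ?p (complex_of_real x) = poly ?q (complex_of_real x)" for x
  proof -
    have "(complex_of_real x \<cdot>\<^sub>m mat_poly_eval (P (Suc n)) x) $$ (i, l) =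
        (mat_poly_eval (P (Suc (Suc n))) x + B (Suc n) * mat_poly_eval (P (Suc n)) x
          + C (Suc n) * mat_poly_eval (P n) x) $$ (i, l)"
      using rec by (simp add: three_term_coeffs_def)
    then show ?thesis
      using BC carrier[of _ x] i l
      by (simp add: scalar_prod_def atLeast0LessThan poly_sum carrier_matD[OF carrier] entry)
  qed
  then have roots: "range complex_of_real \<subseteq> {x. poly (?p - ?q) x = 0}"
    by (auto simp only: poly_diff right_minus_eq)
  have "infinite (range complex_of_real)"
    by (simp add: range_inj_infinite inj_of_real infinite_UNIV_char_0)
  then have "infinite {x. poly (?p - ?q) x = 0}"
    using finite_subset[OF roots] by blast
  then have "?p - ?q = 0"
    using poly_roots_finite by blast
  then show ?thesis
    by (simp only: right_minus_eq)
qed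

text \<open>Pairing the recurrence with a row of \<open>P n\<close> kills the terms with \<open>P (n + 2)\<close> and \<open>P (n + 1)\<close>,
  and leaves \<open>C(n + 1)\<^sub>i\<^sub>j \<H>(n)\<^sub>j\<^sub>j\<close>. Moving the factor \<open>x\<close> to the other side shows that this equals
  \<open>\<H>(n + 1)\<^sub>i\<^sub>j\<close>.\<close>

lemma recurrence_coefficient_diagonal:
  assumes rec: "three_term_coeffs N P B C" and i: "i < N" and j: "j < N" and "i \<noteq> j"
  shows "C (Suc n) $$ (i, j) = 0"
proof -
  have "0 = row_inner (\<lambda>l. [:0, 1:] * P_row (Suc n) i l) (P_row n j)"
    unfolding row_inner_mult_X row_inner_X_mult[OF i j] using assms by (simp add: row_inner_diagonal)
  also have "\<dots> = row_inner (P_row (Suc (Suc n)) i) (P_row n j)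
      + (\<Sum>s<N. B (Suc n) $$ (i, s) * row_inner (P_row (Suc n) s) (P_row n j))
      + (\<Sum>s<N. C (Suc n) $$ (i, s) * row_inner (P_row n s) (P_row n j))"
    by (subst row_inner_cong[OF recurrence_rows[OF rec i]], assumption)
       (simp only: row_inner_add row_inner_sum row_inner_smult)
  also have "\<dots> = (\<Sum>s<N. C (Suc n) $$ (i, s) * row_inner (P_row n s) (P_row n j))"
    using i j by (simp add: rows_orthogonal)
  also have "\<dots> = C (Suc n) $$ (i, j) * row_inner (P_row n j) (P_row n j)"
    using j by (subst sum.remove[of _ j]) (auto simp: row_inner_diagonal intro!: sum.neutral)
  finally show ?thesis
    using row_inner_self_nonzero[OF j] by simp
qed

end

theorem lemma5p4:
  fixes N :: nat
    and \<alpha> :: "nat \<Rightarrow> real"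
    and P :: "nat \<Rightarrow> complex poly mat"
    and B C :: "nat \<Rightarrow> complex mat"
  assumes "1 \<le> N"
    and "\<And>i. i < N \<Longrightarrow> 0 < \<alpha> i"
    and "monic_mvops N (hermite_weight N \<alpha>) P"
    and "three_term_coeffs N P B C"
  shows "\<forall>n. diagonal_mat (sq_norm N (hermite_weight N \<alpha>) P n) \<and> diagonal_mat (C n)"
proof
  fix n
  interpret hermite_mvops N \<alpha> P
    using assms by unfold_locales
  have "diagonal_mat (sq_norm N (hermite_weight N \<alpha>) P n)"
  proof -
    have "sq_norm N (hermite_weight N \<alpha>) P n \<in> carrier_mat N N"
      by (simp add: sq_norm_def mv_inner_def)
    then show ?thesis
      by (auto simp: diagonal_mat_def sq_norm_eq_row_inner row_inner_diagonal)
  qed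
  moreover have "diagonal_mat (C n)"
  proof -
    have "C n \<in> carrier_mat N N" "C 0 = 0\<^sub>m N N"
      using assms(4) by (auto simp: three_term_coeffs_def)
    then show ?thesis
      by (cases n) (auto simp: diagonal_mat_def recurrence_coefficient_diagonal[OF assms(4)])
  qed
  ultimately show "diagonal_mat (sq_norm N (hermite_weight N \<alpha>) P n) \<and> diagonal_mat (C n)" ..
qed

end
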